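(* Let $(T,\tau,\sigma)$ be a countable second-countable bi-topological space with a bi-computable numbering $x$. Let $(T',\tau',\sigma')$ be bi-effective such that the strong inclusions $\prec_{B^{\tau'}}$ and $\prec_{B^{\sigma'}}$ are computably enumerable, and let $x'$ be a numbering of $T'$ that allows effective bi-limit passing. Then every effectively bi-continuous map $F:T\to T'$ is an effective operator.
   Context: Conventions: computable pairing $\langle\cdot,\cdot\rangle$, Gödel numbering $\varphi$, $W_i=\mathrm{dom}(\varphi_i)$, $P^{(n)}$ partial computable $n$-ary functions; a numbering of $S$ is a partial surjection $\nu:\mathbb{N}\rightharpoonup S$. Each of $\tau,\sigma,\tau',\sigma'$ is $T_0$ with a countable basis numbered by $B^\tau,B^\sigma,B^{\tau'},B^{\sigma'}$ and a transitive relation $\prec$ on $\mathbb{N}$ (e.g. $\prec_{B^{\tau'}}$) that is a strong inclusion ($m\prec n$, both in the domain, implies $B_m\subseteq B_n$) and makes the basis strong (if $z\in B_m\cap B_n$ there is $a$ in the domain with $z\in B_a$, $a\prec m$, $a\prec n$). A numbering $x$ is computable w.r.t. a topology if there is a c.e. $L$ with $\langle i,n\rangle\in L\iff x_i\in B_n$ ($i\in\mathrm{dom}(x)$, $n\in\mathrm{dom}(B)$); bi-computable = computable w.r.t. both topologies. A space with numbering $x$ is effective if its basis numbering $B$ is total and there is $sb\in P^{(3)}$ such that $x_i\in B_m\cap B_n$ implies $sb(i,m,n)$ defined, $x_i\in B_{sb(i,m,n)}$, $sb(i,m,n)\prec m,n$; a bi-topological space is bi-effective if both of its topological spaces are effective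 (w.r.t. the given numbering). A normed computable enumeration is a total computable $f$ with range in $\mathrm{dom}(B)$, $f(a+1)\prec f(a)$; any Gödel number of $f$ is an index; it converges to $y$ if $\{B_{f(a)}\}$ is a basis of the neighbourhood filter of $y$. $x'$ allows effective bi-limit passing if there is $pt\in P^{(1)}$ such that whenever $m_{\tau'},m_{\sigma'}$ are indices of normed computable enumerations of basic open sets of $\tau'$, $\sigma'$ respectively converging to the same $y$, then $pt(\langle m_{\tau'},m_{\sigma'}\rangle)\in\mathrm{dom}(x')$ is defined and equals an index of $y$. Lacombe sets for basis numbering $B$: $L_n=\bigcup\{B_a:a\in W_n\}$ if $W_n\subseteq\mathrm{dom}(B)$. $F$ is effectively continuous w.r.t. $\tau,\tau'$ if there is $g\in P^{(1)}$ with $g(n)\in\mathrm{dom}(L^\tau)$ and $F^{-1}[B^{\tau'}_n]=L^\tau_{g(n)}$ for all $n\in\mathrm{dom}(B^{\tau'})$; effectively bi-continuous means effectively continuous w.r.t. $\tau,\tau'$ and w.r.t. $\sigma,\sigma'$. $F$ is an effective operator if there is $f\in P^{(1)}$ with $f(i)\in\mathrm{dom}(x')$ and $F(x_i)=x'_{f(i)}$ for all $i\in\mathrm{dom}(x)$. *)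

theory Defs
  imports "HOL-Analysis.Analysis" "HOL-Library.Nat_Bijection"
begin

section \<open>Partial computable functions\<close>

text \<open>
  Kleene's schemes: zero, successor, projection (from 0), composition, primitive recursion on the
  first argument, and unbounded minimization in the first argument.
\<close>

datatype recf = Zr | Sc | Pj nat | Cn recf "recf list" | Pr recf recf | Mn recf

text \<open>
  Programs carry no arity. The same program may be run on argument lists of any length, and a
  basic step that lacks its arguments is undefined. By induction on programs, every program
  computes, for each \<open>n\<close>, a partial recursive function of \<open>n\<close> arguments; so no well-formedness
  condition is needed to obtain exactly the partial recursive functions.
  Composition is strict, and minimization requires all earlier values to be defined.
\<close>

primrec eval :: "recf \<Rightarrow> nat list \<Rightarrow> nat option" where
  "eval Zr xs = Some 0"
| "eval Sc xs = (case xs of [x] \<Rightarrow> Some (Suc x) | _ \<Rightarrow> None)"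
| "eval (Pj i) xs = (if i < length xs then Some (xs ! i) else None)"
| "eval (Cn f gs) xs = Option.bind (those (map (\<lambda>g. eval g xs) gs)) (eval f)"
| "eval (Pr f g) xs =
     (case xs of
        [] \<Rightarrow> None
      | n # ys \<Rightarrow> rec_nat (eval f ys) (\<lambda>m r. Option.bind r (\<lambda>v. eval g (m # v # ys))) n)"
| "eval (Mn f) xs =
     (if \<exists>n. eval f (n # xs) = Some 0 \<and> (\<forall>m<n. \<exists>v>0. eval f (m # xs) = Some v)
      then Some (LEAST n. eval f (n # xs) = Some 0)
      else None)"

definition P1 :: "(nat \<Rightarrow> nat option) set" where
  "P1 = {f. \<exists>p. \<forall>a. f a = eval p [a]}"

definition P2 :: "(nat \<Rightarrow> nat \<Rightarrow> nat option) set" where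
  "P2 = {f. \<exists>p. \<forall>a b. f a b = eval p [a, b]}"

definition P3 :: "(nat \<Rightarrow> nat \<Rightarrow> nat \<Rightarrow> nat option) set" where
  "P3 = {f. \<exists>p. \<forall>a b c. f a b c = eval p [a, b, c]}"

definition total_computable :: "(nat \<Rightarrow> nat) \<Rightarrow> bool" where
  "total_computable f \<longleftrightarrow> (\<lambda>a. Some (f a)) \<in> P1"

definition ce :: "nat set \<Rightarrow> bool" where
  "ce A \<longleftrightarrow> (\<exists>f \<in> P1. A = dom f)"

text \<open>The computable pairing is the library's \<^const>\<open>prod_encode\<close>.\<close>

definition ce_rel :: "(nat \<Rightarrow> nat \<Rightarrow> bool) \<Rightarrow> bool" where
  "ce_rel R \<longleftrightarrow> ce {prod_encode (m, n) | m n. R m n}"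

text \<open>
  A Goedel numbering (acceptable numbering, in the sense of Rogers) of the unary partial computable
  functions: it has a computable universal function and satisfies the s-m-n property.
\<close>

definition goedel_numbering :: "(nat \<Rightarrow> nat \<Rightarrow> nat option) \<Rightarrow> bool" where
  "goedel_numbering \<phi> \<longleftrightarrow>
     range \<phi> = P1 \<and> \<phi> \<in> P2 \<and>
     (\<forall>h \<in> P2. \<exists>s. total_computable s \<and> (\<forall>i. \<phi> (s i) = h i))"

definition W :: "(nat \<Rightarrow> nat \<Rightarrow> nat option) \<Rightarrow> nat \<Rightarrow> nat set" where
  "W \<phi> i = dom (\<phi> i)"


section \<open>Numberings and strong bases\<close>

definition numbering :: "'a set \<Rightarrow> (nat \<Rightarrow> 'a option) \<Rightarrow> bool" where
  "numbering S \<nu> \<longleftrightarrow> ran \<nu> = S"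

definition basis_numbering :: "'a topology \<Rightarrow> (nat \<Rightarrow> 'a set option) \<Rightarrow> bool" where
  "basis_numbering X B \<longleftrightarrow> openin X = arbitrary union_of (\<lambda>U. U \<in> ran B)"

definition strong_inclusion ::
  "(nat \<Rightarrow> 'a set option) \<Rightarrow> (nat \<Rightarrow> nat \<Rightarrow> bool) \<Rightarrow> bool" where
  "strong_inclusion B prec \<longleftrightarrow>
     transp prec \<and>
     (\<forall>m \<in> dom B. \<forall>n \<in> dom B. prec m n \<longrightarrow> the (B m) \<subseteq> the (B n))"

definition strong_basis ::
  "(nat \<Rightarrow> 'a set option) \<Rightarrow> (nat \<Rightarrow> nat \<Rightarrow> bool) \<Rightarrow> bool" where
  "strong_basis B prec \<longleftrightarrow>
     (\<forall>m \<in> dom B. \<forall>n \<in> dom B. \<forall>z \<in> the (B m) \<inter> the (B n).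
        \<exists>a \<in> dom B. z \<in> the (B a) \<and> prec a m \<and> prec a n)"

definition strong_t0_space ::
  "'a topology \<Rightarrow> (nat \<Rightarrow> 'a set option) \<Rightarrow> (nat \<Rightarrow> nat \<Rightarrow> bool) \<Rightarrow> bool" where
  "strong_t0_space X B prec \<longleftrightarrow>
     t0_space X \<and> basis_numbering X B \<and> strong_inclusion B prec \<and> strong_basis B prec"

definition bitopological :: "'a set \<Rightarrow> 'a topology \<Rightarrow> 'a topology \<Rightarrow> bool" where
  "bitopological T \<tau> \<sigma> \<longleftrightarrow> topspace \<tau> = T \<and> topspace \<sigma> = T"


section \<open>Effectivity notions\<close>

definition computable_numbering ::
  "(nat \<Rightarrow> 'a option) \<Rightarrow> (nat \<Rightarrow> 'a set option) \<Rightarrow> bool" where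
  "computable_numbering x B \<longleftrightarrow>
     (\<exists>L. ce L \<and>
        (\<forall>i \<in> dom x. \<forall>n \<in> dom B. prod_encode (i, n) \<in> L \<longleftrightarrow> the (x i) \<in> the (B n)))"

definition bi_computable ::
  "(nat \<Rightarrow> 'a option) \<Rightarrow> (nat \<Rightarrow> 'a set option) \<Rightarrow> (nat \<Rightarrow> 'a set option) \<Rightarrow> bool" where
  "bi_computable x B\<tau> B\<sigma> \<longleftrightarrow> computable_numbering x B\<tau> \<and> computable_numbering x B\<sigma>"

definition effective_space ::
  "(nat \<Rightarrow> 'a option) \<Rightarrow> (nat \<Rightarrow> 'a set option) \<Rightarrow> (nat \<Rightarrow> nat \<Rightarrow> bool) \<Rightarrow> bool" where
  "effective_space x B prec \<longleftrightarrow>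
     dom B = UNIV \<and>
     (\<exists>sb \<in> P3. \<forall>i \<in> dom x. \<forall>m n. the (x i) \<in> the (B m) \<inter> the (B n) \<longrightarrow>
        (\<exists>a. sb i m n = Some a \<and> the (x i) \<in> the (B a) \<and> prec a m \<and> prec a n))"

definition bi_effective ::
  "(nat \<Rightarrow> 'a option) \<Rightarrow>
   (nat \<Rightarrow> 'a set option) \<Rightarrow> (nat \<Rightarrow> nat \<Rightarrow> bool) \<Rightarrow>
   (nat \<Rightarrow> 'a set option) \<Rightarrow> (nat \<Rightarrow> nat \<Rightarrow> bool) \<Rightarrow> bool" where
  "bi_effective x B\<tau> prec\<tau> B\<sigma> prec\<sigma> \<longleftrightarrow>
     effective_space x B\<tau> prec\<tau> \<and> effective_space x B\<sigma> prec\<sigma>"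

definition normed_enumeration ::
  "(nat \<Rightarrow> 'a set option) \<Rightarrow> (nat \<Rightarrow> nat \<Rightarrow> bool) \<Rightarrow> (nat \<Rightarrow> nat) \<Rightarrow> bool" where
  "normed_enumeration B prec f \<longleftrightarrow>
     total_computable f \<and> range f \<subseteq> dom B \<and> (\<forall>a. prec (f (Suc a)) (f a))"

definition nhds_basis :: "'a topology \<Rightarrow> 'a \<Rightarrow> 'a set set \<Rightarrow> bool" where
  "nhds_basis X y \<F> \<longleftrightarrow>
     y \<in> topspace X \<and>
     (\<forall>U. (\<forall>\<^sub>F z in nhdsin X y. z \<in> U) \<longleftrightarrow> (\<exists>V \<in> \<F>. V \<subseteq> U))"

definition enum_converges ::
  "'a topology \<Rightarrow> (nat \<Rightarrow> 'a set option) \<Rightarrow> (nat \<Rightarrow> nat) \<Rightarrow> 'a \<Rightarrow> bool" where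
  "enum_converges X B f y \<longleftrightarrow> nhds_basis X y {the (B (f a)) | a. True}"

definition converging_index ::
  "(nat \<Rightarrow> nat \<Rightarrow> nat option) \<Rightarrow> 'a topology \<Rightarrow> (nat \<Rightarrow> 'a set option) \<Rightarrow>
   (nat \<Rightarrow> nat \<Rightarrow> bool) \<Rightarrow> nat \<Rightarrow> 'a \<Rightarrow> bool" where
  "converging_index \<phi> X B prec m y \<longleftrightarrow>
     (\<exists>f. \<phi> m = (\<lambda>a. Some (f a)) \<and> normed_enumeration B prec f \<and> enum_converges X B f y)"

definition allows_effective_bi_limit_passing ::
  "(nat \<Rightarrow> nat \<Rightarrow> nat option) \<Rightarrow> (nat \<Rightarrow> 'a option) \<Rightarrow>
   'a topology \<Rightarrow> (nat \<Rightarrow> 'a set option) \<Rightarrow> (nat \<Rightarrow> nat \<Rightarrow> bool) \<Rightarrow>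
   'a topology \<Rightarrow> (nat \<Rightarrow> 'a set option) \<Rightarrow> (nat \<Rightarrow> nat \<Rightarrow> bool) \<Rightarrow> bool" where
  "allows_effective_bi_limit_passing \<phi> x \<tau> B\<tau> prec\<tau> \<sigma> B\<sigma> prec\<sigma> \<longleftrightarrow>
     (\<exists>pt \<in> P1. \<forall>m n y.
        converging_index \<phi> \<tau> B\<tau> prec\<tau> m y \<and> converging_index \<phi> \<sigma> B\<sigma> prec\<sigma> n y \<longrightarrow>
        (\<exists>j. pt (prod_encode (m, n)) = Some j \<and> x j = Some y))"

definition lacombe ::
  "(nat \<Rightarrow> nat \<Rightarrow> nat option) \<Rightarrow> (nat \<Rightarrow> 'a set option) \<Rightarrow> nat \<Rightarrow> 'a set option" where
  "lacombe \<phi> B n = (if W \<phi> n \<subseteq> dom B then Some (\<Union>a \<in> W \<phi> n. the (B a)) else None)"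

definition effectively_continuous ::
  "(nat \<Rightarrow> nat \<Rightarrow> nat option) \<Rightarrow> 'a set \<Rightarrow> (nat \<Rightarrow> 'a set option) \<Rightarrow>
   (nat \<Rightarrow> 'b set option) \<Rightarrow> ('a \<Rightarrow> 'b) \<Rightarrow> bool" where
  "effectively_continuous \<phi> T B B' F \<longleftrightarrow>
     (\<exists>g \<in> P1. \<forall>n \<in> dom B'.
        \<exists>k. g n = Some k \<and> lacombe \<phi> B k = Some {z \<in> T. F z \<in> the (B' n)})"

definition effectively_bi_continuous ::
  "(nat \<Rightarrow> nat \<Rightarrow> nat option) \<Rightarrow> 'a set \<Rightarrow>
   (nat \<Rightarrow> 'a set option) \<Rightarrow> (nat \<Rightarrow> 'a set option) \<Rightarrow>
   (nat \<Rightarrow> 'b set option) \<Rightarrow> (nat \<Rightarrow> 'b set option) \<Rightarrow> ('a \<Rightarrow> 'b) \<Rightarrow> bool" where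
  "effectively_bi_continuous \<phi> T B\<tau> B\<sigma> B\<tau>' B\<sigma>' F \<longleftrightarrow>
     effectively_continuous \<phi> T B\<tau> B\<tau>' F \<and> effectively_continuous \<phi> T B\<sigma> B\<sigma>' F"

definition effective_operator ::
  "(nat \<Rightarrow> 'a option) \<Rightarrow> (nat \<Rightarrow> 'b option) \<Rightarrow> ('a \<Rightarrow> 'b) \<Rightarrow> bool" where
  "effective_operator x x' F \<longleftrightarrow>
     (\<exists>f \<in> P1. \<forall>i \<in> dom x. \<exists>j. f i = Some j \<and> x' j = Some (F (the (x i))))"

end

theory Submission
  imports Defs
begin

text \<open>
  Every partial recursive function is the limit of decidable stages, so computably enumerable
  predicates are projections of decidable ones, and nonempty searches through them are computable.
  By effective continuity and the computability of \<open>x\<close>, the set of indices of basic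
  neighbourhoods of \<open>F x\<^sub>i\<close> is enumerable uniformly in \<open>i\<close>. It is directed with respect to the
  strong inclusion, so a search produces, again uniformly in \<open>i\<close>, a descending sequence in it that
  undercuts each of its elements: a normed enumeration converging to \<open>F x\<^sub>i\<close>. The s-m-n property
  yields indices of these enumerations for both topologies, to which bi-limit passing applies.
\<close>

section \<open>Closure properties of the recursive functions\<close>

text \<open>Programs carry no arity, so the arity enters as the length of the argument list. Values
  of \<open>f\<close> on lists of any other length do not matter, which the congruence rules
  exploit.\<close>

definition partial_recursive :: "nat \<Rightarrow> (nat list \<Rightarrow> nat option) \<Rightarrow> bool" where
  "partial_recursive n f \<longleftrightarrow> (\<exists>p. \<forall>xs. length xs = n \<longrightarrow> eval p xs = f xs)"

definition total_recursive :: "nat \<Rightarrow> (nat list \<Rightarrow> nat) \<Rightarrow> bool" where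
  "total_recursive n f \<longleftrightarrow> partial_recursive n (\<lambda>xs. Some (f xs))"

text \<open>Truth is coded by 0 because \<open>Mn\<close> searches for a zero.\<close>

definition decidable :: "nat \<Rightarrow> (nat list \<Rightarrow> bool) \<Rightarrow> bool" where
  "decidable n P \<longleftrightarrow> total_recursive n (\<lambda>xs. if P xs then 0 else 1)"

section \<open>Composition and substitution\<close>

lemma partial_recursive_cong:
  assumes "partial_recursive n f" "\<And>xs. length xs = n \<Longrightarrow> f xs = g xs"
  shows "partial_recursive n g"
  using assms unfolding partial_recursive_def by auto

lemma total_recursive_cong:
  assumes "total_recursive n f" "\<And>xs. length xs = n \<Longrightarrow> f xs = g xs"
  shows "total_recursive n g"
  using assms unfolding total_recursive_def by (auto elim: partial_recursive_cong)

lemma decidable_cong: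
  assumes "decidable n P" "\<And>xs. length xs = n \<Longrightarrow> P xs \<longleftrightarrow> Q xs"
  shows "decidable n Q"
  using assms unfolding decidable_def by (auto elim: total_recursive_cong)

lemma those_map_Some: "those (map (\<lambda>z. Some (f z)) zs) = Some (map f zs)"
  by (induction zs) auto

lemma those_eq_Some_iff: "those ys = Some zs \<longleftrightarrow> ys = map Some zs"
  by (induction ys arbitrary: zs) (auto split: option.splits simp: map_eq_Cons_conv)

lemma partial_recursive_compose:
  assumes "partial_recursive (length gs) f" "\<And>g. g \<in> set gs \<Longrightarrow> partial_recursive n g"
  shows "partial_recursive n (\<lambda>xs. Option.bind (those (map (\<lambda>g. g xs) gs)) f)"
proof -
  obtain p where p: "\<And>xs. length xs = length gs \<Longrightarrow> eval p xs = f xs"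
    using assms(1) unfolding partial_recursive_def by blast
  obtain P where P: "\<And>g xs. g \<in> set gs \<Longrightarrow> length xs = n \<Longrightarrow> eval (P g) xs = g xs"
    using assms(2) unfolding partial_recursive_def by metis
  have "eval (Cn p (map P gs)) xs = Option.bind (those (map (\<lambda>g. g xs) gs)) f"
    if "length xs = n" for xs
  proof -
    have "map ((\<lambda>g. eval g xs) \<circ> P) gs = map (\<lambda>g. g xs) gs"
      using P that by simp
    then have "eval (Cn p (map P gs)) xs = Option.bind (those (map (\<lambda>g. g xs) gs)) (eval p)"
      by (simp only: eval.simps map_map comp_def)
    \<comment> \<open>The program \<open>p\<close> agrees with \<open>f\<close> only on lists of
      length \<open>length gs\<close>, and every list that \<open>those\<close> returns here has
      that length.\<close>
    also have "\<dots> = Option.bind (those (map (\<lambda>g. g xs) gs)) f"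
    proof (rule Option.bind_cong[OF refl])
      fix zs assume "those (map (\<lambda>g. g xs) gs) = Some zs"
      then show "eval p zs = f zs" using p by (auto simp: those_eq_Some_iff dest: map_eq_imp_length_eq)
    qed
    finally show ?thesis .
  qed
  then show ?thesis
    unfolding partial_recursive_def by blast
qed

lemma total_recursive_compose:
  assumes "total_recursive (length gs) f" "\<And>g. g \<in> set gs \<Longrightarrow> total_recursive n g"
  shows "total_recursive n (\<lambda>xs. f (map (\<lambda>g. g xs) gs))"
proof -
  have "partial_recursive n (\<lambda>xs. Option.bind
      (those (map (\<lambda>g. g xs) (map (\<lambda>g xs. Some (g xs)) gs))) (\<lambda>xs. Some (f xs)))"
    using assms unfolding total_recursive_def by (intro partial_recursive_compose) auto
  then show ?thesis
    unfolding total_recursive_def by (simp add: those_map_Some comp_def)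
qed

text \<open>This is composition with \<open>f\<close> and all the projections. Projections never
  fail on lists of length \<open>n\<close>, so the strictness of composition adds no condition
  besides definedness of \<open>f xs\<close>.\<close>

lemma partial_recursive_bind:
  assumes "partial_recursive (Suc n) g" "partial_recursive n f"
  shows "partial_recursive n (\<lambda>xs. Option.bind (f xs) (\<lambda>v. g (v # xs)))"
proof -
  let ?pjs = "map (\<lambda>i xs. Some (xs ! i)) [0..<n]"
  have pj: "partial_recursive n (\<lambda>xs. Some (xs ! i))" if "i < n" for i
    unfolding partial_recursive_def by (rule exI[of _ "Pj i"]) (use that in auto)
  have "partial_recursive n (\<lambda>xs. Option.bind (those (map (\<lambda>h. h xs) (f # ?pjs))) g)"
    using assms pj by (intro partial_recursive_compose) auto
  then show ?thesis
  proof (rule partial_recursive_cong)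
    fix xs :: "nat list" assume n: "length xs = n"
    have "those (map (\<lambda>i. Some (xs ! i)) [0..<n]) = Some xs"
      using n map_nth[of xs] by (simp add: those_map_Some)
    then show "Option.bind (those (map (\<lambda>h. h xs) (f # ?pjs))) g =
        Option.bind (f xs) (\<lambda>v. g (v # xs))"
      by (cases "f xs") (simp_all add: comp_def)
  qed
qed

lemma total_recursive_nth:
  assumes "i < n" shows "total_recursive n (\<lambda>xs. xs ! i)"
  unfolding total_recursive_def partial_recursive_def
  by (rule exI[of _ "Pj i"]) (use assms in auto)

text \<open>Since \<open>js\<close> may permute, repeat or omit positions, this rule covers every
  rearrangement of an argument list.\<close>

lemma total_recursive_select:
  assumes "total_recursive (length js) f" "\<And>j. j \<in> set js \<Longrightarrow> j < n"
  shows "total_recursive n (\<lambda>xs. f (map ((!) xs) js))"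
  using total_recursive_compose[of "map (\<lambda>j xs. xs ! j) js" f n] assms
  by (auto simp: comp_def intro: total_recursive_nth)

lemma total_recursive_Cons:
  assumes "total_recursive (Suc n) g" "total_recursive n f"
  shows "total_recursive n (\<lambda>xs. g (f xs # xs))"
  using partial_recursive_bind[of n "\<lambda>xs. Some (g xs)" "\<lambda>xs. Some (f xs)"] assms
  unfolding total_recursive_def by simp

lemma total_recursive_drop:
  assumes "total_recursive n f" shows "total_recursive (k + n) (\<lambda>xs. f (drop k xs))"
proof (rule total_recursive_cong)
  show "total_recursive (k + n) (\<lambda>xs. f (map ((!) xs) [k..<k + n]))"
    using assms by (intro total_recursive_select) auto
  fix xs :: "nat list" assume "length xs = k + n"
  then have "map ((!) xs) [k..<k + n] = drop k xs"
    by (intro nth_equalityI) auto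
  then show "f (map ((!) xs) [k..<k + n]) = f (drop k xs)" by simp
qed

section \<open>Primitive recursion and arithmetic\<close>

lemma total_recursive_const: "total_recursive n (\<lambda>xs. c)"
proof -
  have "eval (((\<lambda>p. Cn Sc [p]) ^^ c) Zr) xs = Some c" for xs
    by (induction c) auto
  then show ?thesis
    unfolding total_recursive_def partial_recursive_def by blast
qed

lemma total_recursive_Suc:
  assumes "total_recursive n f" shows "total_recursive n (\<lambda>xs. Suc (f xs))"
proof -
  have "total_recursive 1 (\<lambda>xs. Suc (hd xs))"
    unfolding total_recursive_def partial_recursive_def
    by (rule exI[of _ Sc]) (auto simp: length_Suc_conv)
  then show ?thesis
    using total_recursive_compose[of "[f]" "\<lambda>xs. Suc (hd xs)" n] assms by simp
qed

lemma partial_recursive_rec_nat: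
  assumes "partial_recursive k f" "partial_recursive (Suc (Suc k)) g"
  shows "partial_recursive (Suc k)
    (\<lambda>xs. rec_nat (f (tl xs)) (\<lambda>m r. Option.bind r (\<lambda>v. g (m # v # tl xs))) (hd xs))"
proof -
  obtain p q where pq: "\<And>xs. length xs = k \<Longrightarrow> eval p xs = f xs"
      "\<And>xs. length xs = Suc (Suc k) \<Longrightarrow> eval q xs = g xs"
    using assms unfolding partial_recursive_def by blast
  have "eval (Pr p q) xs =
      rec_nat (f (tl xs)) (\<lambda>m r. Option.bind r (\<lambda>v. g (m # v # tl xs))) (hd xs)"
    if "length xs = Suc k" for xs
    using pq that by (auto simp: length_Suc_conv)
  then show ?thesis
    unfolding partial_recursive_def by blast
qed

text \<open>The step function takes its arguments in the order of \<open>Pr\<close>: counter,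
  previous value, parameters. All values being defined, the option-valued recursion collapses to an
  ordinary one; the recursion argument is then replaced by \<open>c xs\<close>.\<close>

lemma total_recursive_rec_nat:
  assumes "total_recursive n c" "total_recursive n f"
    and "total_recursive (Suc (Suc n)) (\<lambda>ys. g (ys ! 0) (ys ! 1) (drop 2 ys))"
  shows "total_recursive n (\<lambda>xs. rec_nat (f xs) (\<lambda>m r. g m r xs) (c xs))"
proof -
  let ?G = "\<lambda>ys. g (ys ! 0) (ys ! 1) (drop 2 ys)"
  have "partial_recursive (Suc n) (\<lambda>xs. rec_nat (Some (f (tl xs)))
      (\<lambda>m r. Option.bind r (\<lambda>v. Some (?G (m # v # tl xs)))) (hd xs))"
    using assms unfolding total_recursive_def by (intro partial_recursive_rec_nat) auto
  moreover have "rec_nat (Some (f ys)) (\<lambda>m r. Option.bind r (\<lambda>v. Some (?G (m # v # ys)))) k =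
      Some (rec_nat (f ys) (\<lambda>m r. g m r ys) k)" for ys k
    by (induction k) auto
  ultimately have
    "total_recursive (Suc n) (\<lambda>xs. rec_nat (f (tl xs)) (\<lambda>m r. g m r (tl xs)) (hd xs))"
    unfolding total_recursive_def by simp
  from total_recursive_Cons[OF this assms(1)] show ?thesis by simp
qed

lemma total_recursive_add:
  assumes "total_recursive n f" "total_recursive n g"
  shows "total_recursive n (\<lambda>xs. f xs + g xs)"
proof -
  have "total_recursive n (\<lambda>xs. rec_nat (f xs) (\<lambda>m r. Suc r) (g xs))"
    using assms by (intro total_recursive_rec_nat total_recursive_Suc total_recursive_nth) auto
  moreover have "rec_nat a (\<lambda>m r. Suc r) b = a + b" for a b :: nat
    by (induction b) auto
  ultimately show ?thesis by simp
qed

lemma total_recursive_diff: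
  assumes "total_recursive n f" "total_recursive n g"
  shows "total_recursive n (\<lambda>xs. f xs - g xs)"
proof -
  have pred: "total_recursive k (\<lambda>xs. h xs - 1)" if "total_recursive k h" for k h
  proof -
    \<comment> \<open>The predecessor is a recursion that returns its counter and ignores the
      previous value.\<close>
    have "total_recursive k (\<lambda>xs. rec_nat 0 (\<lambda>m r. m) (h xs))"
      using that by (intro total_recursive_rec_nat total_recursive_const total_recursive_nth) auto
    moreover have "rec_nat 0 (\<lambda>m r. m) b = b - 1" for b :: nat
      by (cases b) auto
    ultimately show ?thesis by simp
  qed
  have "total_recursive n (\<lambda>xs. rec_nat (f xs) (\<lambda>m r. r - 1) (g xs))"
    using assms by (intro total_recursive_rec_nat pred total_recursive_nth) auto
  moreover have "rec_nat a (\<lambda>m r. r - 1) b = a - b" for a b :: nat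
    by (induction b) auto
  ultimately show ?thesis by simp
qed

lemma total_recursive_triangle:
  assumes "total_recursive n f" shows "total_recursive n (\<lambda>xs. triangle (f xs))"
proof -
  have "total_recursive n (\<lambda>xs. rec_nat 0 (\<lambda>m r. r + Suc m) (f xs))"
    using assms
    by (intro total_recursive_rec_nat total_recursive_const total_recursive_add
        total_recursive_Suc total_recursive_nth) auto
  moreover have "rec_nat 0 (\<lambda>m r. r + Suc m) b = triangle b" for b
    by (induction b) auto
  ultimately show ?thesis by simp
qed

section \<open>Case distinction, decidable predicates and minimization\<close>

lemma total_recursive_If:
  assumes "decidable n P" "total_recursive n f" "total_recursive n g"
  shows "total_recursive n (\<lambda>xs. if P xs then f xs else g xs)"
proof -
  \<comment> \<open>Recursion on the truth code: no step leaves \<open>f xs\<close>, one step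
    overwrites it with \<open>g xs\<close>.\<close>
  have "total_recursive n
      (\<lambda>xs. rec_nat (f xs) (\<lambda>m r. g xs) (if P xs then 0 else 1))"
    using assms total_recursive_drop[OF assms(3), of 2]
    by (intro total_recursive_rec_nat) (auto simp: decidable_def)
  then show ?thesis
    by (rule total_recursive_cong) simp
qed

lemma decidable_eq_0:
  assumes "total_recursive n f" shows "decidable n (\<lambda>xs. f xs = 0)"
proof -
  \<comment> \<open>Truncated subtraction twice gives the sign: 0 stays 0, every positive value
    becomes 1.\<close>
  have "total_recursive n (\<lambda>xs. 1 - (1 - f xs))"
    using assms by (intro total_recursive_diff total_recursive_const)
  then show ?thesis
    unfolding decidable_def by (rule total_recursive_cong) auto
qed

lemma decidable_le:
  assumes "total_recursive n f" "total_recursive n g"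
  shows "decidable n (\<lambda>xs. f xs \<le> g xs)"
  using decidable_eq_0[OF total_recursive_diff[OF assms]] by simp

lemma decidable_not:
  assumes "decidable n P" shows "decidable n (\<lambda>xs. \<not> P xs)"
  using total_recursive_If[OF assms total_recursive_const[of n 1] total_recursive_const[of n 0]]
  unfolding decidable_def by (rule total_recursive_cong) simp

lemma decidable_conj:
  assumes "decidable n P" "decidable n Q" shows "decidable n (\<lambda>xs. P xs \<and> Q xs)"
  using total_recursive_If[OF assms(1) assms(2)[unfolded decidable_def] total_recursive_const[of n 1]]
  unfolding decidable_def by (rule total_recursive_cong) simp

lemma decidable_disj:
  assumes "decidable n P" "decidable n Q" shows "decidable n (\<lambda>xs. P xs \<or> Q xs)"
  using decidable_not[OF decidable_conj[OF assms[THEN decidable_not]]] by simp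

lemma decidable_imp:
  assumes "decidable n P" "decidable n Q" shows "decidable n (\<lambda>xs. P xs \<longrightarrow> Q xs)"
  using decidable_disj[OF decidable_not[OF assms(1)] assms(2)]
  by (rule decidable_cong) auto

lemma decidable_less:
  assumes "total_recursive n f" "total_recursive n g"
  shows "decidable n (\<lambda>xs. f xs < g xs)"
  using decidable_le[OF total_recursive_Suc[OF assms(1)] assms(2)] by (simp add: Suc_le_eq)

lemma partial_recursive_Least:
  assumes "decidable (Suc n) P"
  shows "partial_recursive n
    (\<lambda>xs. if \<exists>t. P (t # xs) then Some (LEAST t. P (t # xs)) else None)"
proof -
  obtain p where p: "\<And>xs. length xs = Suc n \<Longrightarrow> eval p xs = Some (if P xs then 0 else 1)"
    using assms unfolding decidable_def total_recursive_def partial_recursive_def by blast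
  have "eval (Mn p) xs = (if \<exists>t. P (t # xs) then Some (LEAST t. P (t # xs)) else None)"
    if "length xs = n" for xs
  proof -
    have e: "eval p (t # xs) = Some 0 \<longleftrightarrow> P (t # xs)"
      "(\<exists>v>0. eval p (t # xs) = Some v) \<longleftrightarrow> \<not> P (t # xs)" for t
      using p[of "t # xs"] that by auto
    \<comment> \<open>At the least solution all earlier values are defined and positive, so the side
      condition of \<open>Mn\<close> reduces to the existence of a solution.\<close>
    have "(\<exists>t. P (t # xs) \<and> (\<forall>s<t. \<not> P (s # xs))) \<longleftrightarrow> (\<exists>t. P (t # xs))"
      using exists_least_iff[of "\<lambda>t. P (t # xs)"] by blast
    then show ?thesis
      by (simp only: eval.simps e)
  qed
  then show ?thesis
    unfolding partial_recursive_def by blast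
qed

lemma total_recursive_Least:
  assumes "decidable (Suc n) P" "\<And>xs. length xs = n \<Longrightarrow> \<exists>t. P (t # xs)"
  shows "total_recursive n (\<lambda>xs. LEAST t. P (t # xs))"
  unfolding total_recursive_def
  by (rule partial_recursive_cong[OF partial_recursive_Least[OF assms(1)]]) (use assms(2) in auto)

lemma total_recursive_subst1:
  assumes "total_recursive 1 (\<lambda>ys. f (ys ! 0))" "total_recursive n g"
  shows "total_recursive n (\<lambda>xs. f (g xs))"
  using total_recursive_compose[of "[g]" "\<lambda>ys. f (ys ! 0)" n] assms by simp

lemma decidable_subst3:
  assumes "decidable 3 (\<lambda>ys. D (ys ! 0) (ys ! 1) (ys ! 2))"
    and "total_recursive n f" "total_recursive n g" "total_recursive n h"
  shows "decidable n (\<lambda>xs. D (f xs) (g xs) (h xs))"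
  using total_recursive_compose[of "[f, g, h]" "\<lambda>ys. if D (ys ! 0) (ys ! 1) (ys ! 2) then 0 else 1" n]
    assms by (auto simp: decidable_def numeral_3_eq_3)

section \<open>The pairing function and its inverses\<close>

lemma total_recursive_prod_encode:
  assumes "total_recursive n f" "total_recursive n g"
  shows "total_recursive n (\<lambda>xs. prod_encode (f xs, g xs))"
  unfolding prod_encode_def using assms
  by (auto intro!: total_recursive_add total_recursive_triangle)

text \<open>The code of \<open>(a, b)\<close> is \<open>triangle (a + b) + a\<close>, which lies
  from \<open>triangle (a + b)\<close> on and before the next triangular number. A search thus
  recovers the diagonal \<open>a + b\<close>, the key to decoding pairs recursively.\<close>

lemma Least_triangle: "(LEAST r. prod_encode (a, b) < triangle (Suc r)) = a + b"
proof (rule Least_equality)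
  show "prod_encode (a, b) < triangle (Suc (a + b))"
    by (simp add: prod_encode_def)
  have mono: "triangle m \<le> triangle n" if "m \<le> n" for m n
    using that by (induction rule: dec_induct) auto
  show "a + b \<le> r" if "prod_encode (a, b) < triangle (Suc r)" for r
  proof (rule ccontr)
    assume "\<not> a + b \<le> r"
    then have "triangle (Suc r) \<le> triangle (a + b)" by (intro mono) simp
    then show False using that by (simp add: prod_encode_def)
  qed
qed

lemma total_recursive_prod_decode:
  assumes "total_recursive n f"
  shows "total_recursive n (\<lambda>xs. fst (prod_decode (f xs)))"
    and "total_recursive n (\<lambda>xs. snd (prod_decode (f xs)))"
proof -
  \<comment> \<open>The diagonal on which \<open>u\<close> lies. The first component is the distance
    of \<open>u\<close> from the start of this diagonal, the second is what remains of the
    sum.\<close>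
  define root where "root u = (LEAST r. u < triangle (Suc r))" for u
  have root: "root u = fst (prod_decode u) + snd (prod_decode u)" for u
    unfolding root_def using Least_triangle[of "fst (prod_decode u)" "snd (prod_decode u)"] by simp
  have fst: "fst (prod_decode u) = u - triangle (root u)" for u
  proof -
    obtain a b where "u = prod_encode (a, b)" by (metis surj_pair prod_decode_inverse)
    then show ?thesis by (simp add: root) (simp add: prod_encode_def)
  qed
  have "decidable 2 (\<lambda>xs. xs ! 1 < triangle (Suc (xs ! 0)))"
    by (intro decidable_less total_recursive_triangle total_recursive_Suc total_recursive_nth) auto
  then have "decidable (Suc 1) (\<lambda>xs. xs ! 1 < triangle (Suc (xs ! 0)))"
    by (simp add: numeral_2_eq_2)
  then have "total_recursive 1 (\<lambda>xs. LEAST r. (r # xs) ! 1 < triangle (Suc ((r # xs) ! 0)))"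
  proof (rule total_recursive_Least, intro exI)
    fix xs :: "nat list"
    \<comment> \<open>The code itself bounds its diagonal, so the search always ends.\<close>
    show "(xs ! 0 # xs) ! 1 < triangle (Suc ((xs ! 0 # xs) ! 0))"
      by simp
  qed
  then have "total_recursive 1 (\<lambda>xs. root (xs ! 0))"
    unfolding root_def by simp
  then have r: "total_recursive n (\<lambda>xs. root (f xs))"
    using assms by (rule total_recursive_subst1)
  then show f: "total_recursive n (\<lambda>xs. fst (prod_decode (f xs)))"
    unfolding fst using assms by (intro total_recursive_diff total_recursive_triangle)
  have "total_recursive n (\<lambda>xs. root (f xs) - fst (prod_decode (f xs)))"
    using r f by (rule total_recursive_diff)
  then show "total_recursive n (\<lambda>xs. snd (prod_decode (f xs)))"
    by (simp add: root)
qed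


section \<open>Stages of a computation\<close>

text \<open>The value is 0 while no result has been found, and \<open>Suc v\<close> once the result \<open>v\<close> is known;
  the bound \<open>t\<close> restricts only the minimizations.\<close>

primrec stage :: "recf \<Rightarrow> nat \<Rightarrow> nat list \<Rightarrow> nat" where
  "stage Zr t xs = 1"
| "stage Sc t xs = (case xs of [x] \<Rightarrow> Suc (Suc x) | _ \<Rightarrow> 0)"
| "stage (Pj i) t xs = (if i < length xs then Suc (xs ! i) else 0)"
| "stage (Cn f gs) t xs =
     (if 0 \<in> set (map (\<lambda>g. stage g t xs) gs) then 0
      else stage f t (map (\<lambda>y. y - 1) (map (\<lambda>g. stage g t xs) gs)))"
| "stage (Pr f g) t xs =
     (case xs of
        [] \<Rightarrow> 0
      | n # ys \<Rightarrow>
          rec_nat (stage f t ys) (\<lambda>m r. if r = 0 then 0 else stage g t (m # (r - 1) # ys)) n)"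
| "stage (Mn f) t xs =
     (if (LEAST n. t \<le> n \<or> stage f t (n # xs) \<le> 1) < t \<and>
         stage f t ((LEAST n. t \<le> n \<or> stage f t (n # xs) \<le> 1) # xs) = 1
      then Suc (LEAST n. t \<le> n \<or> stage f t (n # xs) \<le> 1) else 0)"

text \<open>A nonzero code requires nonzero codes of the subcomputations it rests on, so induction
  applies. In a minimization, the arguments before the stopping point have codes above 1, which
  certify defined positive values.\<close>

lemma stage_sound: "stage p t xs = Suc v \<Longrightarrow> eval p xs = Some v"
proof (induction p arbitrary: xs v)
  case Sc
  then show ?case by (auto split: list.splits)
next
  case (Cn f gs)
  let ?ys = "map (\<lambda>g. stage g t xs - 1) gs"
  have nz: "stage g t xs \<noteq> 0" if "g \<in> set gs" for g
    using Cn.prems that by (fastforce split: if_splits)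
  have f: "stage f t ?ys = Suc v"
    using Cn.prems by (simp add: comp_def split: if_splits)
  have "eval g xs = Some (stage g t xs - 1)" if "g \<in> set gs" for g
    using Cn.IH(2)[OF that] nz[OF that] by simp
  then have "map (\<lambda>g. eval g xs) gs = map (\<lambda>g. Some (stage g t xs - 1)) gs"
    by simp
  then have "those (map (\<lambda>g. eval g xs) gs) = Some ?ys"
    by (simp only: those_map_Some)
  then show ?case
    using Cn.IH(1)[OF f] by (simp only: eval.simps bind.bind_lunit)
next
  case (Pr f g)
  then obtain n ys where xs: "xs = n # ys" by (cases xs) auto
  have "rec_nat (stage f t ys) (\<lambda>m r. if r = 0 then 0 else stage g t (m # (r - 1) # ys)) n = Suc v
    \<Longrightarrow> rec_nat (eval f ys) (\<lambda>m r. Option.bind r (\<lambda>v. eval g (m # v # ys))) n = Some v" for v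
  proof (induction n arbitrary: v)
    case 0
    then show ?case using Pr.IH(1) by simp
  next
    case (Suc n)
    let ?r = "rec_nat (stage f t ys) (\<lambda>m r. if r = 0 then 0 else stage g t (m # (r - 1) # ys)) n"
    have "?r \<noteq> 0" using Suc.prems by (auto split: if_splits)
    then obtain u where u: "?r = Suc u" by (cases ?r) auto
    then have "stage g t (n # u # ys) = Suc v"
      using Suc.prems by simp
    then show ?case using Suc.IH[OF u] Pr.IH(2) by simp
  qed
  then show ?case using Pr.prems xs by simp
next
  case (Mn f)
  \<comment> \<open>The condition that ends the capped search: the bound is exhausted, or the code
    is 0 (no result yet) or 1 (the value is zero).\<close>
  define Q where "Q n \<longleftrightarrow> t \<le> n \<or> stage f t (n # xs) \<le> 1" for n
  define n where "n = (LEAST n. Q n)"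
  have n: "stage f t (n # xs) = 1" "n = v" "n < t"
    using Mn.prems unfolding n_def Q_def by (auto split: if_splits)
  have zero: "eval f (n # xs) = Some 0" using Mn.IH n by simp
  have pos: "\<exists>w>0. eval f (m # xs) = Some w" if "m < n" for m
  proof -
    have "\<not> Q m" using that unfolding n_def by (rule not_less_Least)
    then obtain w where "stage f t (m # xs) = Suc (Suc w)"
      unfolding Q_def by (metis One_nat_def le_add1 not_less_eq_eq old.nat.exhaust plus_1_eq_Suc)
    then show ?thesis using Mn.IH by blast
  qed
  have "(LEAST m. eval f (m # xs) = Some 0) = n"
    by (rule Least_equality) (use zero pos in \<open>fastforce simp: not_less[symmetric]\<close>)+
  then show ?case using zero pos n by auto
qed (auto split: if_splits)

text \<open>Claiming the equation for all large \<open>t\<close>, not just for some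
  \<open>t\<close>, lets the finitely many subcomputations involved share a bound without any
  argument about monotonicity in \<open>t\<close>.\<close>

lemma stage_complete:
  "eval p xs = Some v \<Longrightarrow> \<forall>\<^sub>F t in sequentially. stage p t xs = Suc v"
proof (induction p arbitrary: xs v)
  case Sc
  then show ?case by (auto split: list.splits)
next
  case (Cn f gs)
  obtain ys where ys: "those (map (\<lambda>g. eval g xs) gs) = Some ys" and f: "eval f ys = Some v"
    using Cn.prems by (auto simp: bind_eq_Some_conv)
  have eq: "map (\<lambda>g. eval g xs) gs = map Some ys"
    using ys by (simp add: those_eq_Some_iff)
  have "\<forall>\<^sub>F t in sequentially. \<forall>g\<in>set gs. stage g t xs = Suc (the (eval g xs))"
  proof (rule eventually_ball_finite)
    show "\<forall>g\<in>set gs. \<forall>\<^sub>F t in sequentially. stage g t xs = Suc (the (eval g xs))"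
    proof
      fix g assume g: "g \<in> set gs"
      then have "eval g xs \<in> set (map Some ys)" unfolding eq[symmetric] by simp
      then show "\<forall>\<^sub>F t in sequentially. stage g t xs = Suc (the (eval g xs))"
        using Cn.IH(2)[OF g] by auto
    qed
  qed simp
  then show ?case
    using Cn.IH(1)[OF f]
  proof eventually_elim
    case (elim t)
    have "map the (map (\<lambda>g. eval g xs) gs) = ys" unfolding eq by (simp add: comp_def)
    then have "map (\<lambda>g. stage g t xs - 1) gs = ys" using elim(1) by (auto simp: comp_def)
    then show ?case using elim by (auto simp: comp_def)
  qed
next
  case (Pr f g)
  then obtain n ys where xs: "xs = n # ys" by (cases xs) auto
  have "rec_nat (eval f ys) (\<lambda>m r. Option.bind r (\<lambda>v. eval g (m # v # ys))) n = Some v \<Longrightarrow>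
    \<forall>\<^sub>F t in sequentially.
      rec_nat (stage f t ys) (\<lambda>m r. if r = 0 then 0 else stage g t (m # (r - 1) # ys)) n = Suc v" for v
  proof (induction n arbitrary: v)
    case 0
    then show ?case using Pr.IH(1) by simp
  next
    case (Suc n)
    obtain u where
      u: "rec_nat (eval f ys) (\<lambda>m r. Option.bind r (\<lambda>v. eval g (m # v # ys))) n = Some u"
      and g: "eval g (n # u # ys) = Some v"
      using Suc.prems by (auto simp: bind_eq_Some_conv)
    show ?case
      using Suc.IH[OF u] Pr.IH(2)[OF g] by eventually_elim simp
  qed
  then show ?case using Pr.prems xs by simp
next
  case (Mn f)
  have "\<exists>n. eval f (n # xs) = Some 0 \<and> (\<forall>m<n. \<exists>w>0. eval f (m # xs) = Some w)"
    using Mn.prems by (auto split: if_splits)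
  then obtain n where n: "eval f (n # xs) = Some 0"
    and lt: "\<And>m. m < n \<Longrightarrow> \<exists>w>0. eval f (m # xs) = Some w" by blast
  have "(LEAST m. eval f (m # xs) = Some 0) = n"
    by (rule Least_equality) (use n lt in \<open>fastforce simp: not_less[symmetric]\<close>)+
  then have v: "v = n" using Mn.prems by (auto split: if_splits)
  \<comment> \<open>For large \<open>t\<close> no argument below \<open>n\<close> stops the search
    early; once also \<open>t > n\<close>, the cap does not interfere and the search ends exactly at
    \<open>n\<close>.\<close>
  have "\<forall>\<^sub>F t in sequentially. \<forall>m\<in>{..<n}. 1 < stage f t (m # xs)"
  proof (rule eventually_ball_finite)
    show "\<forall>m\<in>{..<n}. \<forall>\<^sub>F t in sequentially. 1 < stage f t (m # xs)"
    proof
      fix m assume "m \<in> {..<n}"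
      then obtain w where w: "w > 0" "eval f (m # xs) = Some w" using lt by auto
      show "\<forall>\<^sub>F t in sequentially. 1 < stage f t (m # xs)"
        using Mn.IH[OF w(2)] by eventually_elim (use w in simp)
    qed
  qed simp
  then show ?case
    using Mn.IH[OF n] eventually_gt_at_top[of n]
  proof eventually_elim
    case (elim t)
    have "(LEAST m. t \<le> m \<or> stage f t (m # xs) \<le> 1) = n"
      by (rule Least_equality) (use elim in \<open>fastforce simp: not_less[symmetric]\<close>)+
    then show ?case using elim v by simp
  qed
qed (auto split: if_splits)

text \<open>Code 0 makes undefinedness an ordinary value and the cap makes every search finite, so
  each scheme becomes total. The arity is generalized because subprograms are run on argument lists
  of other lengths.\<close>

lemma total_recursive_stage:
  "total_recursive (Suc n) (\<lambda>ys. stage p (ys ! 0) (drop 1 ys))"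
proof (induction p arbitrary: n)
  case Zr
  then show ?case using total_recursive_const by simp
next
  case Sc
  show ?case
  proof (cases "n = 1")
    case True
    have "total_recursive (Suc n) (\<lambda>ys. Suc (Suc (ys ! 1)))"
      using True by (intro total_recursive_Suc total_recursive_nth) simp
    then show ?thesis
      by (rule total_recursive_cong) (auto simp: True length_Suc_conv)
  next
    case False
    show ?thesis
      by (rule total_recursive_cong[OF total_recursive_const[of _ 0]])
        (use False in \<open>auto simp: length_Suc_conv split: list.splits\<close>)
  qed
next
  case (Pj i)
  show ?case
  proof (cases "i < n")
    case True
    then have "total_recursive (Suc n) (\<lambda>ys. Suc (ys ! Suc i))"
      by (intro total_recursive_Suc total_recursive_nth) simp
    then show ?thesis
      by (rule total_recursive_cong) (use True in auto)
  next
    case False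
    show ?thesis
      by (rule total_recursive_cong[OF total_recursive_const[of _ 0]]) (use False in auto)
  qed
next
  case (Cn f gs)
  let ?G = "\<lambda>g ys. stage g (ys ! 0) (drop 1 ys)"
  \<comment> \<open>Whether some inner computation still lacks a result is a finite disjunction,
    built up along the list of programs.\<close>
  have none: "decidable (Suc n) (\<lambda>ys. 0 \<in> (\<lambda>g. ?G g ys) ` set hs)"
    if "set hs \<subseteq> set gs" for hs
    using that
  proof (induction hs)
    case Nil
    show ?case using total_recursive_const[of _ 1] by (simp add: decidable_def)
  next
    case (Cons h hs)
    have "decidable (Suc n) (\<lambda>ys. ?G h ys = 0 \<or> 0 \<in> (\<lambda>g. ?G g ys) ` set hs)"
      using Cons Cn.IH(2) by (intro decidable_disj decidable_eq_0) auto
    then show ?case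
      by (rule decidable_cong) auto
  qed
  have f: "total_recursive (Suc n) (\<lambda>ys. ?G f (map (\<lambda>h. h ys)
      ((\<lambda>ys. ys ! 0) # map (\<lambda>g ys. ?G g ys - 1) gs)))"
    using Cn.IH
    by (intro total_recursive_compose)
      (auto intro!: total_recursive_nth total_recursive_diff total_recursive_const simp del: One_nat_def)
  show ?case
    by (rule total_recursive_cong[OF
          total_recursive_If[OF none[OF subset_refl] total_recursive_const[of _ 0] f]])
      (auto simp: comp_def)
next
  case (Pr f g)
  show ?case
  proof (cases n)
    case 0
    show ?thesis
      by (rule total_recursive_cong[OF total_recursive_const[of _ 0]]) (use 0 in auto)
  next
    case (Suc k)
    \<comment> \<open>The base case sees the parameters without the recursion argument, which sits
      at position 1 behind the bound.\<close>
    have f: "total_recursive (Suc n) (\<lambda>ys. stage f (ys ! 0) (drop 2 ys))"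
    proof (rule total_recursive_cong)
      show "total_recursive (Suc n) (\<lambda>ys. stage f (map ((!) ys) (0 # [2..<Suc n]) ! 0)
          (drop 1 (map ((!) ys) (0 # [2..<Suc n]))))"
        using Pr.IH(1)[of k] Suc
        by (intro total_recursive_select[where f = "\<lambda>ys. stage f (ys ! 0) (drop 1 ys)"])
          (auto simp del: upt_Suc)
      fix ys :: "nat list" assume "length ys = Suc n"
      then have "map ((!) ys) [2..<Suc n] = drop 2 ys"
        by (intro nth_equalityI) (auto simp del: upt_Suc)
      then show "stage f (map ((!) ys) (0 # [2..<Suc n]) ! 0)
          (drop 1 (map ((!) ys) (0 # [2..<Suc n]))) = stage f (ys ! 0) (drop 2 ys)"
        by simp
    qed
    \<comment> \<open>The list \<open>zs\<close> holds the counter, the coded previous value, the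
      bound, the recursion argument and the parameters. Subtracting 1 decodes the previous
      value.\<close>
    have g: "total_recursive (Suc (Suc (Suc n)))
      (\<lambda>zs. stage g (drop 2 zs ! 0) (zs ! 0 # (zs ! 1 - 1) # drop 4 zs))"
    proof (rule total_recursive_cong)
      let ?hs = "(\<lambda>zs. zs ! 2) # (\<lambda>zs. zs ! 0) # (\<lambda>zs. zs ! 1 - 1) # map (\<lambda>i zs. zs ! i) [4..<k + 4]"
      show "total_recursive (Suc (Suc (Suc n)))
          (\<lambda>zs. stage g (map (\<lambda>h. h zs) ?hs ! 0) (drop 1 (map (\<lambda>h. h zs) ?hs)))"
        using Pr.IH(2)[of "Suc (Suc k)"] Suc
        by (intro total_recursive_compose[where f = "\<lambda>ys. stage g (ys ! 0) (drop 1 ys)"])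
          (auto intro!: total_recursive_nth total_recursive_diff total_recursive_const
            simp del: One_nat_def)
      fix zs :: "nat list" assume len: "length zs = Suc (Suc (Suc n))"
      then have "map ((!) zs) [4..<k + 4] = drop 4 zs"
        using Suc by (intro nth_equalityI) (auto simp del: upt_Suc)
      then show "stage g (map (\<lambda>h. h zs) ?hs ! 0) (drop 1 (map (\<lambda>h. h zs) ?hs)) =
          stage g (drop 2 zs ! 0) (zs ! 0 # (zs ! 1 - 1) # drop 4 zs)"
        using len by (simp add: comp_def)
    qed
    have "total_recursive (Suc n) (\<lambda>ys. rec_nat (stage f (ys ! 0) (drop 2 ys))
        (\<lambda>m r. if r = 0 then 0 else stage g (ys ! 0) (m # (r - 1) # drop 2 ys)) (ys ! 1))"
      using Suc f g
      by (intro total_recursive_rec_nat total_recursive_If decidable_eq_0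
          total_recursive_const total_recursive_nth) (auto simp: numeral_eq_Suc)
    then show ?thesis
      by (rule total_recursive_cong) (use Suc in \<open>auto simp: length_Suc_conv cong: if_cong\<close>)
  qed
next
  case (Mn f)
  let ?F = "\<lambda>zs. stage f (zs ! 1) (zs ! 0 # drop 2 zs)"
  have F: "total_recursive (Suc (Suc n)) ?F"
  proof (rule total_recursive_cong)
    show "total_recursive (Suc (Suc n)) (\<lambda>ys. stage f (map ((!) ys) (1 # 0 # [2..<Suc (Suc n)]) ! 0)
        (drop 1 (map ((!) ys) (1 # 0 # [2..<Suc (Suc n)]))))"
      using Mn.IH[of "Suc n"]
      by (intro total_recursive_select[where f = "\<lambda>ys. stage f (ys ! 0) (drop 1 ys)"])
        (auto simp del: upt_Suc)
    fix ys :: "nat list" assume "length ys = Suc (Suc n)"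
    then have "map ((!) ys) [2..<Suc (Suc n)] = drop 2 ys"
      by (intro nth_equalityI) (auto simp del: upt_Suc)
    then show "stage f (map ((!) ys) (1 # 0 # [2..<Suc (Suc n)]) ! 0)
        (drop 1 (map ((!) ys) (1 # 0 # [2..<Suc (Suc n)]))) = ?F ys"
      by simp
  qed
  have "decidable (Suc (Suc n)) (\<lambda>zs. zs ! 1 \<le> zs ! 0 \<or> ?F zs \<le> 1)"
    using F by (intro decidable_disj decidable_le total_recursive_nth total_recursive_const) auto
  \<comment> \<open>The bound satisfies the first disjunct, so the minimization is total.\<close>
  then have "total_recursive (Suc n)
      (\<lambda>ys. LEAST m. (m # ys) ! 1 \<le> (m # ys) ! 0 \<or> ?F (m # ys) \<le> 1)"
    by (rule total_recursive_Least) (rule exI, auto)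
  then have L: "total_recursive (Suc n)
      (\<lambda>ys. LEAST m. ys ! 0 \<le> m \<or> stage f (ys ! 0) (m # drop 1 ys) \<le> 1)" (is "total_recursive _ ?L")
    by simp
  have "total_recursive (Suc n) (\<lambda>ys. ?F (?L ys # ys))"
    using F L by (rule total_recursive_Cons)
  then have FL: "total_recursive (Suc n) (\<lambda>ys. stage f (ys ! 0) (?L ys # drop 1 ys))"
    by simp
  have "decidable (Suc n) (\<lambda>ys. ?L ys < ys ! 0 \<and> \<not> stage f (ys ! 0) (?L ys # drop 1 ys) \<le> 0 \<and>
      stage f (ys ! 0) (?L ys # drop 1 ys) \<le> 1)"
    using L FL by (intro decidable_conj decidable_less decidable_le decidable_not
        total_recursive_nth total_recursive_const) auto
  then have dec: "decidable (Suc n)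
      (\<lambda>ys. ?L ys < ys ! 0 \<and> stage f (ys ! 0) (?L ys # drop 1 ys) = 1)"
    by (rule decidable_cong) auto
  show ?case
    unfolding stage.simps
    by (intro total_recursive_If dec total_recursive_Suc L total_recursive_const)
qed

text \<open>A form of Kleene's normal form for domains: the witness \<open>t\<close> is a bound
  whose stage has a nonzero code. Completeness of the stages supplies it, and soundness gives the
  converse.\<close>

lemma decidable_stages:
  assumes "partial_recursive n f"
  obtains D where "decidable (Suc n) D"
    "\<And>xs. length xs = n \<Longrightarrow> f xs \<noteq> None \<longleftrightarrow> (\<exists>t. D (t # xs))"
proof -
  obtain p where p: "\<And>xs. length xs = n \<Longrightarrow> eval p xs = f xs"
    using assms unfolding partial_recursive_def by blast
  have "decidable (Suc n) (\<lambda>ys. \<not> stage p (ys ! 0) (drop 1 ys) = 0)"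
    by (intro decidable_not decidable_eq_0 total_recursive_stage)
  moreover have "f xs \<noteq> None \<longleftrightarrow> (\<exists>t. \<not> stage p ((t # xs) ! 0) (drop 1 (t # xs)) = 0)"
    if len: "length xs = n" for xs
  proof
    assume "f xs \<noteq> None"
    then obtain v where "eval p xs = Some v" using p[OF len] by auto
    from stage_complete[OF this] obtain t where "stage p t xs = Suc v"
      unfolding eventually_sequentially by blast
    then show "\<exists>t. \<not> stage p ((t # xs) ! 0) (drop 1 (t # xs)) = 0"
      by (intro exI[of _ t]) simp
  next
    assume "\<exists>t. \<not> stage p ((t # xs) ! 0) (drop 1 (t # xs)) = 0"
    then obtain t where "stage p t xs \<noteq> 0" by auto
    then obtain v where "stage p t xs = Suc v" by (cases "stage p t xs") auto
    from stage_sound[OF this] show "f xs \<noteq> None" using p[OF len] by simp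
  qed
  ultimately show thesis by (rule that)
qed


section \<open>Descending chains through enumerable filters\<close>

text \<open>The number searched for pairs an answer with its witnesses. Only the answer is returned,
  but the conclusion keeps the whole \<open>t\<close>, so that the witnesses remain available in
  proofs.\<close>

lemma partial_recursive_search:
  assumes "decidable (Suc n) P"
  obtains f where "partial_recursive n f"
    "\<And>xs. \<exists>t. P (t # xs) \<Longrightarrow> \<exists>t. f xs = Some (fst (prod_decode t)) \<and> P (t # xs)"
proof
  let ?L = "\<lambda>xs. if \<exists>t. P (t # xs) then Some (LEAST t. P (t # xs)) else None"
  have "total_recursive (Suc n) (\<lambda>ys. fst (prod_decode (ys ! 0)))"
    by (intro total_recursive_prod_decode total_recursive_nth) simp
  then show "partial_recursive n
      (\<lambda>xs. Option.bind (?L xs) (\<lambda>v. Some (fst (prod_decode ((v # xs) ! 0)))))"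
    unfolding total_recursive_def
    by (rule partial_recursive_bind) (rule partial_recursive_Least[OF assms])
  show "\<exists>t. Option.bind (?L xs) (\<lambda>v. Some (fst (prod_decode ((v # xs) ! 0)))) =
      Some (fst (prod_decode t)) \<and> P (t # xs)" if "\<exists>t. P (t # xs)" for xs
    using that by (auto intro: LeastI)
qed

text \<open>Membership and relation are only semidecidable, given by definedness of \<open>N\<close>
  and \<open>R\<close>. Nonemptiness starts the chain, and directedness makes every search for a
  next element succeed. One \<open>f\<close> serves all \<open>i\<close>, as the s-m-n property
  demands; where the hypotheses on \<open>i\<close> fail, nothing is claimed about
  \<open>f i\<close>.\<close>

lemma computable_descending_chain:
  assumes N: "partial_recursive 2 N" and R: "partial_recursive 2 R"
  obtains f where "f \<in> P2"
    "\<And>i. \<lbrakk>\<exists>n. N [i, n] \<noteq> None;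
          \<And>m n. \<lbrakk>N [i, m] \<noteq> None; N [i, n] \<noteq> None\<rbrakk> \<Longrightarrow>
            \<exists>a. N [i, a] \<noteq> None \<and> R [a, m] \<noteq> None \<and> R [a, n] \<noteq> None\<rbrakk> \<Longrightarrow>
       \<exists>h. f i = (\<lambda>s. Some (h s)) \<and> (\<forall>s. N [i, h s] \<noteq> None) \<and> (\<forall>s. R [h (Suc s), h s] \<noteq> None) \<and>
           (\<forall>n. N [i, n] \<noteq> None \<longrightarrow> (\<exists>s. R [h s, n] \<noteq> None))"
proof -
  obtain D' where D': "decidable (Suc 2) D'"
      "\<And>xs. length xs = 2 \<Longrightarrow> N xs \<noteq> None \<longleftrightarrow> (\<exists>t. D' (t # xs))"
    using decidable_stages[OF N] by blast
  obtain E' where E': "decidable (Suc 2) E'"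
      "\<And>xs. length xs = 2 \<Longrightarrow> R xs \<noteq> None \<longleftrightarrow> (\<exists>t. E' (t # xs))"
    using decidable_stages[OF R] by blast
  define D where "D u i n \<longleftrightarrow> D' [u, i, n]" for u i n
  define E where "E u a b \<longleftrightarrow> E' [u, a, b]" for u a b
  have D: "N [i, n] \<noteq> None \<longleftrightarrow> (\<exists>t. D t i n)" for i n
    unfolding D_def using D'(2)[of "[i, n]"] by simp
  have E: "R [a, b] \<noteq> None \<longleftrightarrow> (\<exists>t. E t a b)" for a b
    unfolding E_def using E'(2)[of "[a, b]"] by simp
  have "decidable 3 D'" using D'(1) by simp
  then have "decidable 3 (\<lambda>ys. D (ys ! 0) (ys ! 1) (ys ! 2))"
    by (rule decidable_cong) (auto simp: D_def length_Suc_conv numeral_eq_Suc)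
  note dD = decidable_subst3[OF this]
  have "decidable 3 E'" using E'(1) by simp
  then have "decidable 3 (\<lambda>ys. E (ys ! 0) (ys ! 1) (ys ! 2))"
    by (rule decidable_cong) (auto simp: E_def length_Suc_conv numeral_eq_Suc)
  note dE = decidable_subst3[OF this]

  define d1 where "d1 u = fst (prod_decode u)" for u
  define d2 where "d2 u = snd (prod_decode u)" for u
  have td: "total_recursive n (\<lambda>xs. d1 (g xs))" "total_recursive n (\<lambda>xs. d2 (g xs))"
    if "total_recursive n g" for n g
    unfolding d1_def d2_def using that by (rule total_recursive_prod_decode)+

  \<comment> \<open>The first component of the searched pair is the initial element, the second a
    stage that certifies its membership.\<close>
  have "decidable (Suc 1) (\<lambda>ys. D (d2 (ys ! 0)) (ys ! 1) (d1 (ys ! 0)))"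
    by (intro dD td total_recursive_nth) auto
  then obtain start where start: "partial_recursive 1 start"
    "\<And>xs. \<exists>t. D (d2 t) (xs ! 0) (d1 t) \<Longrightarrow>
       \<exists>t. start xs = Some (d1 t) \<and> D (d2 t) (xs ! 0) (d1 t)"
    unfolding d1_def by (rule partial_recursive_search) (auto simp: d1_def)

  text \<open>A candidate \<open>t\<close> packs an element \<open>d1 t\<close> with its three witnesses; the stage number \<open>s\<close>
    is itself read as an element \<open>d1 s\<close> with a witness \<open>d2 s\<close>, so that all elements are
    eventually undercut.\<close>
  define step where "step t s r i \<longleftrightarrow>
      D (d1 (d2 t)) i (d1 t) \<and> E (d1 (d2 (d2 t))) (d1 t) r \<and>
      (D (d2 s) i (d1 s) \<longrightarrow> E (d2 (d2 (d2 t))) (d1 t) (d1 s))" for t s r i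
  have "decidable (Suc 3) (\<lambda>ys. step (ys ! 0) (ys ! 1) (ys ! 2) (ys ! 3))"
    unfolding step_def
    by (intro decidable_conj decidable_imp dD dE td total_recursive_nth) auto
  then obtain "next" where "next": "partial_recursive 3 next"
    "\<And>s r i. \<exists>t. step t s r i \<Longrightarrow> \<exists>t. next [s, r, i] = Some (d1 t) \<and> step t s r i"
    unfolding d1_def by (rule partial_recursive_search) (force simp: numeral_eq_Suc)

  define f where "f i s = rec_nat (start [i]) (\<lambda>s r. Option.bind r (\<lambda>v. next [s, v, i])) s" for i s
  have "partial_recursive (Suc 1) (\<lambda>xs. rec_nat (start (tl xs))
      (\<lambda>m r. Option.bind r (\<lambda>v. next (m # v # tl xs))) (hd xs))"
    using start(1) "next"(1) by (intro partial_recursive_rec_nat) (simp_all add: numeral_3_eq_3)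
  then obtain p where p: "\<And>xs. length xs = 2 \<Longrightarrow> eval p xs = rec_nat (start (tl xs))
      (\<lambda>m r. Option.bind r (\<lambda>v. next (m # v # tl xs))) (hd xs)"
    unfolding partial_recursive_def by (auto simp: numeral_2_eq_2)
  \<comment> \<open>Recursion runs on the first argument of \<open>p\<close>, whereas the family
    index \<open>i\<close> has to come first in \<open>f\<close>; the projections swap them.\<close>
  have "f i s = eval (Cn p [Pj 1, Pj 0]) [i, s]" for i s
    by (simp add: p f_def)
  then have "f \<in> P2" unfolding P2_def by blast
  moreover
  have "\<exists>h. f i = (\<lambda>s. Some (h s)) \<and> (\<forall>s. N [i, h s] \<noteq> None) \<and> (\<forall>s. R [h (Suc s), h s] \<noteq> None) \<and>
      (\<forall>n. N [i, n] \<noteq> None \<longrightarrow> (\<exists>s. R [h s, n] \<noteq> None))"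
    if ex: "\<exists>n. N [i, n] \<noteq> None"
      and dir: "\<And>m n. \<lbrakk>N [i, m] \<noteq> None; N [i, n] \<noteq> None\<rbrakk> \<Longrightarrow>
        \<exists>a. N [i, a] \<noteq> None \<and> R [a, m] \<noteq> None \<and> R [a, n] \<noteq> None" for i
  proof -
    have 0: "\<exists>v. f i 0 = Some v \<and> N [i, v] \<noteq> None"
    proof -
      obtain n u where "D u i n" using ex unfolding D by blast
      then have "\<exists>t. D (d2 t) ([i] ! 0) (d1 t)"
        by (intro exI[of _ "prod_encode (n, u)"]) (simp add: d1_def d2_def)
      from start(2)[OF this] show ?thesis
        unfolding D f_def by auto
    qed
    have next_ex: "\<exists>t. step t s v i" if v: "N [i, v] \<noteq> None" for s v
    proof -
      \<comment> \<open>If \<open>s\<close> names a certified element, that element is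
        \<open>m\<close>; otherwise \<open>v\<close> can be taken, so directedness applies in both
        cases.\<close>
      obtain m where m: "N [i, m] \<noteq> None" "D (d2 s) i (d1 s) \<Longrightarrow> m = d1 s"
        using v D by metis
      obtain a where "N [i, a] \<noteq> None" "R [a, v] \<noteq> None" "R [a, m] \<noteq> None"
        using dir[OF v m(1)] by blast
      then obtain u w w' where "D u i a" "E w a v" "E w' a m"
        unfolding D E by blast
      then show ?thesis
        using m(2) unfolding step_def
        by (intro exI[of _ "prod_encode (a, prod_encode (u, prod_encode (w, w')))"])
          (auto simp: d1_def d2_def)
    qed
    have f_Suc: "\<exists>t. f i (Suc s) = Some (d1 t) \<and> step t s v i"
      if "f i s = Some v" "N [i, v] \<noteq> None" for s v
      using "next"(2)[OF next_ex[OF that(2), of s]] that(1) unfolding f_def by simp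
    have step_N: "N [i, d1 t] \<noteq> None" if "step t s v i" for t s v
      unfolding D using that unfolding step_def by blast
    have all: "\<exists>v. f i s = Some v \<and> N [i, v] \<noteq> None" for s
    proof (induction s)
      case (Suc s)
      then show ?case using f_Suc step_N by metis
    qed (rule 0)
    define h where "h s = the (f i s)" for s
    have h: "f i s = Some (h s)" "N [i, h s] \<noteq> None" for s
      using all[of s] unfolding h_def by auto
    have hstep: "\<exists>t. h (Suc s) = d1 t \<and> step t s (h s) i" for s
      using f_Suc[OF h[of s]] h(1)[of "Suc s"] by auto
    have "R [h (Suc s), h s] \<noteq> None" for s
      using hstep[of s] unfolding E step_def by auto
    moreover have "\<exists>s. R [h s, n] \<noteq> None" if n: "N [i, n] \<noteq> None" for n
    proof -
      obtain u where "D u i n" using n unfolding D by blast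
      \<comment> \<open>The code of \<open>n\<close> with its witness \<open>u\<close> serves as the
        stage number: at this stage the search has to go below \<open>n\<close>.\<close>
      then have "R [h (Suc (prod_encode (n, u))), n] \<noteq> None"
        using hstep[of "prod_encode (n, u)"] unfolding E step_def by (auto simp: d1_def d2_def)
      then show ?thesis by blast
    qed
    ultimately show ?thesis using h by blast
  qed
  ultimately show thesis by (rule that)
qed

section \<open>Effective continuity and limits\<close>

lemma P1_iff: "f \<in> P1 \<longleftrightarrow> partial_recursive 1 (\<lambda>xs. f (xs ! 0))"
proof -
  have "(\<forall>a. f a = eval p [a]) \<longleftrightarrow> (\<forall>xs. length xs = 1 \<longrightarrow> eval p xs = f (xs ! 0))" for p
    by (auto simp: length_Suc_conv)
  then show ?thesis
    by (simp add: P1_def partial_recursive_def)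
qed

lemma P2_iff: "f \<in> P2 \<longleftrightarrow> partial_recursive 2 (\<lambda>xs. f (xs ! 0) (xs ! 1))"
proof -
  have "(\<forall>a b. f a b = eval p [a, b]) \<longleftrightarrow>
      (\<forall>xs. length xs = 2 \<longrightarrow> eval p xs = f (xs ! 0) (xs ! 1))" for p
    by (auto simp: length_Suc_conv numeral_2_eq_2)
  then show ?thesis
    by (simp add: P2_def partial_recursive_def)
qed

lemma partial_recursive_subst1:
  assumes "f \<in> P1" "total_recursive n g"
  shows "partial_recursive n (\<lambda>xs. f (g xs))"
  using partial_recursive_compose[of "[\<lambda>xs. Some (g xs)]" "\<lambda>ys. f (ys ! 0)" n] assms
  by (simp add: P1_iff total_recursive_def)

text \<open>With the universal function \<open>\<phi>\<close> as \<open>f\<close>, this runs a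
  program whose index is itself the result of a computation.\<close>

lemma partial_recursive_bind_P2:
  assumes "f \<in> P2" "partial_recursive n g" "total_recursive n h"
  shows "partial_recursive n (\<lambda>xs. Option.bind (g xs) (\<lambda>k. f k (h xs)))"
proof (rule partial_recursive_cong)
  let ?hs = "[g, \<lambda>xs. Some (h xs)]"
  show "partial_recursive n
      (\<lambda>xs. Option.bind (those (map (\<lambda>h. h xs) ?hs)) (\<lambda>ys. f (ys ! 0) (ys ! 1)))"
    using assms
    by (intro partial_recursive_compose) (auto simp: P2_iff total_recursive_def numeral_2_eq_2)
  show "Option.bind (those (map (\<lambda>h. h xs) ?hs)) (\<lambda>ys. f (ys ! 0) (ys ! 1)) =
      Option.bind (g xs) (\<lambda>k. f k (h xs))" for xs
    by (cases "g xs") auto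
qed

text \<open>It expresses the conjunction of two semidecidable conditions: the domain is the
  intersection of both domains.\<close>

lemma partial_recursive_then:
  assumes "partial_recursive n f" "partial_recursive n g"
  shows "partial_recursive n (\<lambda>xs. Option.bind (f xs) (\<lambda>_. g xs))"
proof (rule partial_recursive_cong)
  have "total_recursive 2 (\<lambda>ys. ys ! 1)" by (rule total_recursive_nth) simp
  then show "partial_recursive n
      (\<lambda>xs. Option.bind (those (map (\<lambda>h. h xs) [f, g])) (\<lambda>ys. Some (ys ! 1)))"
    using assms
    by (intro partial_recursive_compose) (auto simp: total_recursive_def numeral_2_eq_2)
  show "Option.bind (those (map (\<lambda>h. h xs) [f, g])) (\<lambda>ys. Some (ys ! 1)) =
      Option.bind (f xs) (\<lambda>_. g xs)" for xs
    by (cases "f xs"; cases "g xs") auto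
qed

text \<open>Candidate and stage bound are searched together as one pair, so a computation that
  diverges at one candidate does not block the others. Only the domain of \<open>g\<close>
  matters.\<close>

lemma partial_recursive_ex:
  assumes "partial_recursive (Suc n) f"
  obtains g where "partial_recursive n g"
    "\<And>xs. length xs = n \<Longrightarrow> g xs \<noteq> None \<longleftrightarrow> (\<exists>a. f (a # xs) \<noteq> None)"
proof -
  obtain D where D: "decidable (Suc (Suc n)) D"
    "\<And>xs. length xs = Suc n \<Longrightarrow> f xs \<noteq> None \<longleftrightarrow> (\<exists>t. D (t # xs))"
    using decidable_stages[OF assms] by blast
  define P where "P ys \<longleftrightarrow>
    D (snd (prod_decode (ys ! 0)) # fst (prod_decode (ys ! 0)) # drop 1 ys)" for ys
  have "decidable (Suc n) P"
  proof -
    let ?hs = "(\<lambda>ys. snd (prod_decode (ys ! 0))) # (\<lambda>ys. fst (prod_decode (ys ! 0))) #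
      map (\<lambda>i ys. ys ! i) [1..<Suc n]"
    have "total_recursive (Suc n) (\<lambda>ys. if D (map (\<lambda>h. h ys) ?hs) then 0 else 1)"
      using D(1) unfolding decidable_def
      by (intro total_recursive_compose)
        (auto simp del: upt_Suc intro!: total_recursive_nth total_recursive_prod_decode)
    moreover have "map (\<lambda>i. ys ! i) [1..<Suc n] = drop 1 ys" if "length ys = Suc n" for ys :: "nat list"
      using that by (intro nth_equalityI) (auto simp del: upt_Suc)
    ultimately show ?thesis
      unfolding decidable_def P_def
      by (elim total_recursive_cong) (simp add: comp_def del: upt_Suc)
  qed
  from partial_recursive_Least[OF this] show thesis
  proof (rule that)
    fix xs :: "nat list" assume len: "length xs = n"
    have "(\<exists>u. P (u # xs)) \<longleftrightarrow> (\<exists>a t. D (t # a # xs))"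
    proof
      assume "\<exists>a t. D (t # a # xs)"
      then obtain a t where "D (t # a # xs)" by blast
      then show "\<exists>u. P (u # xs)"
        by (intro exI[of _ "prod_encode (a, t)"]) (simp add: P_def)
    qed (auto simp: P_def)
    also have "\<dots> \<longleftrightarrow> (\<exists>a. f (a # xs) \<noteq> None)"
      using D(2)[of "_ # xs"] len by simp
    finally show "(if \<exists>t. P (t # xs) then Some (LEAST t. P (t # xs)) else None) \<noteq> None \<longleftrightarrow>
        (\<exists>a. f (a # xs) \<noteq> None)" by simp
  qed
qed

text \<open>The point lies in the preimage of \<open>B' n\<close> exactly if some basic set listed
  by the Lacombe index \<open>g n\<close> contains it. Being listed and containing the point are
  both semidecidable, and so is the existence of such a set. Totality of \<open>B'\<close> makes
  \<open>g n\<close> defined for every \<open>n\<close>.\<close>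

lemma enumerable_image_neighbourhoods:
  assumes "\<phi> \<in> P2" "ran x = T" "computable_numbering x B" "dom B' = UNIV"
    and "effectively_continuous \<phi> T B B' F"
  obtains N where "partial_recursive 2 N"
    "\<And>i n. i \<in> dom x \<Longrightarrow> N [i, n] \<noteq> None \<longleftrightarrow> F (the (x i)) \<in> the (B' n)"
proof -
  obtain L where "ce L"
    and L: "\<And>i n. i \<in> dom x \<Longrightarrow> n \<in> dom B \<Longrightarrow> prod_encode (i, n) \<in> L \<longleftrightarrow> the (x i) \<in> the (B n)"
    using assms(3) unfolding computable_numbering_def by blast
  then obtain l where l: "l \<in> P1" "L = dom l" unfolding ce_def by blast
  obtain g where g: "g \<in> P1"
    "\<And>n. \<exists>k. g n = Some k \<and> lacombe \<phi> B k = Some {z \<in> T. F z \<in> the (B' n)}"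
    using assms(4,5) unfolding effectively_continuous_def by auto
  \<comment> \<open>The arguments are a candidate basic index, then \<open>i\<close>, then
    \<open>n\<close>; halting says that the candidate is listed by \<open>g n\<close> and that its
    pair with \<open>i\<close> is in \<open>L\<close>.\<close>
  have "partial_recursive (Suc 2) (\<lambda>ys. Option.bind (Option.bind (g (ys ! 2)) (\<lambda>k. \<phi> k (ys ! 0)))
      (\<lambda>_. l (prod_encode (ys ! 1, ys ! 0))))"
    by (intro partial_recursive_then partial_recursive_bind_P2 partial_recursive_subst1
        total_recursive_prod_encode total_recursive_nth assms(1) g(1) l(1)) auto
  then obtain N where N: "partial_recursive 2 N" "\<And>xs. length xs = 2 \<Longrightarrow> N xs \<noteq> None \<longleftrightarrow>
      (\<exists>a. Option.bind (Option.bind (g (xs ! 1)) (\<lambda>k. \<phi> k a)) (\<lambda>_. l (prod_encode (xs ! 0, a))) \<noteq> None)"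
    by (rule partial_recursive_ex) auto
  have "N [i, n] \<noteq> None \<longleftrightarrow> F (the (x i)) \<in> the (B' n)" if i: "i \<in> dom x" for i n
  proof -
    obtain k where k: "g n = Some k" "lacombe \<phi> B k = Some {z \<in> T. F z \<in> the (B' n)}"
      using g(2) by blast
    then have sub: "W \<phi> k \<subseteq> dom B" and eq: "(\<Union>a \<in> W \<phi> k. the (B a)) = {z \<in> T. F z \<in> the (B' n)}"
      unfolding lacombe_def by (auto split: if_splits)
    have "the (x i) \<in> T" using i assms(2) by (auto simp: ran_def)
    then have "F (the (x i)) \<in> the (B' n) \<longleftrightarrow> (\<exists>a\<in>W \<phi> k. the (x i) \<in> the (B a))"
      using eq by blast
    also have "\<dots> \<longleftrightarrow> (\<exists>a\<in>W \<phi> k. prod_encode (i, a) \<in> L)"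
      using L[OF i] sub by blast
    also have "\<dots> \<longleftrightarrow> (\<exists>a. \<phi> k a \<noteq> None \<and> l (prod_encode (i, a)) \<noteq> None)"
      by (auto simp: l(2) W_def)
    also have "\<dots> \<longleftrightarrow> N [i, n] \<noteq> None"
      using N(2)[of "[i, n]"] by (simp add: k(1) bind_eq_None_conv)
    finally show ?thesis by simp
  qed
  with N(1) show thesis by (rule that)
qed

text \<open>Every open neighbourhood of \<open>y\<close> contains a basic one around
  \<open>y\<close>, so it suffices to undercut basic sets. Conversely, each enumerated set is an
  open neighbourhood of \<open>y\<close>, hence so is in the filter everything above it.\<close>

lemma enum_convergesI:
  assumes basis: "basis_numbering X B" and y: "y \<in> topspace X"
    and f: "range f \<subseteq> dom B" "\<And>s. y \<in> the (B (f s))"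
    and cofinal: "\<And>n. \<lbrakk>n \<in> dom B; y \<in> the (B n)\<rbrakk> \<Longrightarrow> \<exists>s. the (B (f s)) \<subseteq> the (B n)"
  shows "enum_converges X B f y"
proof -
  have openin: "openin X = arbitrary union_of (\<lambda>U. U \<in> ran B)"
    using basis unfolding basis_numbering_def .
  have open_f: "openin X (the (B (f s)))" for s
  proof -
    have "f s \<in> dom B" using f(1) by blast
    then have "the (B (f s)) \<in> ran B" by (auto simp: ran_def)
    then show ?thesis
      unfolding openin by (intro arbitrary_union_of_inc)
  qed
  have sub: "\<exists>s. the (B (f s)) \<subseteq> S" if S: "openin X S" "y \<in> S" for S
  proof -
    obtain V where "V \<in> ran B" "y \<in> V" "V \<subseteq> S"
      using S unfolding openin arbitrary_union_of_alt by blast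
    then obtain n where "B n = Some V"
      by (auto simp: ran_def)
    then show ?thesis using cofinal[of n] \<open>y \<in> V\<close> \<open>V \<subseteq> S\<close> by auto
  qed
  show ?thesis
    unfolding enum_converges_def nhds_basis_def eventually_nhdsin
  proof (intro conjI allI iffI)
    fix U assume "y \<notin> topspace X \<or> (\<exists>S. openin X S \<and> y \<in> S \<and> (\<forall>z\<in>S. z \<in> U))"
    then obtain S where "openin X S" "y \<in> S" "S \<subseteq> U" using y by blast
    then obtain s where "the (B (f s)) \<subseteq> U"
      using sub by (meson order_trans)
    then show "\<exists>V\<in>{the (B (f a)) |a. True}. V \<subseteq> U" by blast
  next
    fix U assume "\<exists>V\<in>{the (B (f a)) |a. True}. V \<subseteq> U"
    then obtain s where "the (B (f s)) \<subseteq> U" by blast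
    then show "y \<notin> topspace X \<or> (\<exists>S. openin X S \<and> y \<in> S \<and> (\<forall>z\<in>S. z \<in> U))"
      using open_f f(2) by blast
  qed (rule y)
qed

text \<open>The indices of basic neighbourhoods of \<open>y i\<close> are nonempty as a set because
  the basis covers the space, and directed because the basis is strong. A descending chain through
  them is normed; since \<open>prec\<close> implies inclusion, undercutting every index yields
  convergence.\<close>

lemma computable_converging_indices:
  assumes \<phi>: "goedel_numbering \<phi>" and X: "strong_t0_space X B prec"
    and total: "dom B = UNIV" and ce: "ce_rel prec"
    and N: "partial_recursive 2 N"
    and mem: "\<And>i n. i \<in> I \<Longrightarrow> N [i, n] \<noteq> None \<longleftrightarrow> y i \<in> the (B n)"
    and y: "\<And>i. i \<in> I \<Longrightarrow> y i \<in> topspace X"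
  obtains s where "total_computable s" "\<And>i. i \<in> I \<Longrightarrow> converging_index \<phi> X B prec (s i) (y i)"
proof -
  have basis: "basis_numbering X B" and incl: "\<And>m n. prec m n \<Longrightarrow> the (B m) \<subseteq> the (B n)"
    and dir: "\<And>m n z. z \<in> the (B m) \<Longrightarrow> z \<in> the (B n) \<Longrightarrow> \<exists>a. z \<in> the (B a) \<and> prec a m \<and> prec a n"
    using X unfolding strong_t0_space_def strong_inclusion_def strong_basis_def total by blast+
  obtain r where r: "r \<in> P1" "{prod_encode (m, n) |m n. prec m n} = dom r"
    using ce unfolding ce_rel_def ce_def by blast
  define R where "R xs = r (prod_encode (xs ! 0, xs ! 1))" for xs
  have R_rec: "partial_recursive 2 R"
    unfolding R_def
    by (intro partial_recursive_subst1 r(1) total_recursive_prod_encode total_recursive_nth) auto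
  have R: "R [m, n] \<noteq> None \<longleftrightarrow> prec m n" for m n
  proof -
    have "R [m, n] \<noteq> None \<longleftrightarrow> prod_encode (m, n) \<in> {prod_encode (m, n) |m n. prec m n}"
      unfolding r(2) R_def by (simp add: dom_def)
    then show ?thesis by auto
  qed
  obtain f where f: "f \<in> P2" and chain: "\<And>i. \<lbrakk>\<exists>n. N [i, n] \<noteq> None;
      \<And>m n. \<lbrakk>N [i, m] \<noteq> None; N [i, n] \<noteq> None\<rbrakk> \<Longrightarrow>
        \<exists>a. N [i, a] \<noteq> None \<and> R [a, m] \<noteq> None \<and> R [a, n] \<noteq> None\<rbrakk> \<Longrightarrow>
      \<exists>h. f i = (\<lambda>s. Some (h s)) \<and> (\<forall>s. N [i, h s] \<noteq> None) \<and> (\<forall>s. R [h (Suc s), h s] \<noteq> None) \<and>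
        (\<forall>n. N [i, n] \<noteq> None \<longrightarrow> (\<exists>s. R [h s, n] \<noteq> None))"
    using computable_descending_chain[OF N R_rec] by blast
  obtain s where s: "total_computable s" "\<And>i. \<phi> (s i) = f i"
    using \<phi> f unfolding goedel_numbering_def by blast
  have "converging_index \<phi> X B prec (s i) (y i)" if i: "i \<in> I" for i
  proof -
    have "\<exists>n. y i \<in> the (B n)"
    proof -
      have "openin X (topspace X)" by simp
      then obtain V where "V \<in> ran B" "y i \<in> V"
        using y[OF i] unfolding basis[unfolded basis_numbering_def] arbitrary_union_of_alt by blast
      then obtain n where "B n = Some V" "y i \<in> V" by (auto simp: ran_def)
      then show ?thesis by (intro exI[of _ n]) simp
    qed
    then have ex: "\<exists>n. N [i, n] \<noteq> None"
      unfolding mem[OF i] .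
    have directed: "\<exists>a. N [i, a] \<noteq> None \<and> R [a, m] \<noteq> None \<and> R [a, n] \<noteq> None"
      if "N [i, m] \<noteq> None" "N [i, n] \<noteq> None" for m n
      using dir that unfolding mem[OF i] R .
    have "\<exists>h. f i = (\<lambda>s. Some (h s)) \<and> (\<forall>s. N [i, h s] \<noteq> None) \<and>
        (\<forall>s. R [h (Suc s), h s] \<noteq> None) \<and> (\<forall>n. N [i, n] \<noteq> None \<longrightarrow> (\<exists>s. R [h s, n] \<noteq> None))"
      by (rule chain[OF ex]) (rule directed)
    then obtain h where h: "f i = (\<lambda>s. Some (h s))"
      "\<forall>s. N [i, h s] \<noteq> None" "\<forall>s. R [h (Suc s), h s] \<noteq> None"
      "\<forall>n. N [i, n] \<noteq> None \<longrightarrow> (\<exists>s. R [h s, n] \<noteq> None)"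
      by (elim exE conjE)
    note h = h[unfolded mem[OF i] R]
    \<comment> \<open>Computability of \<open>h\<close> comes from \<open>f i\<close> being
      \<open>\<phi> (s i)\<close>, as the range of \<open>\<phi>\<close> is
      \<open>P1\<close>.\<close>
    have "f i \<in> P1"
      using \<phi> s(2)[of i] unfolding goedel_numbering_def by (metis rangeI)
    then have "normed_enumeration B prec h"
      using h total unfolding normed_enumeration_def total_computable_def by simp
    moreover have "enum_converges X B h (y i)"
    proof (rule enum_convergesI[OF basis y[OF i]])
      show "range h \<subseteq> dom B" using total by simp
      show "y i \<in> the (B (h s))" for s using h(2) ..
      show "\<exists>s. the (B (h s)) \<subseteq> the (B n)" if "y i \<in> the (B n)" for n
        using h(4) that incl by meson
    qed
    ultimately show ?thesis
      unfolding converging_index_def using s(2)[of i] h(1) by auto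
  qed
  with s(1) show thesis by (rule that)
qed

theorem theorem6p10:
  fixes \<phi> :: "nat \<Rightarrow> nat \<Rightarrow> nat option"
    and T :: "'a set" and \<tau> \<sigma> :: "'a topology"
    and B\<tau> B\<sigma> :: "nat \<Rightarrow> 'a set option"
    and prec\<tau> prec\<sigma> :: "nat \<Rightarrow> nat \<Rightarrow> bool"
    and x :: "nat \<Rightarrow> 'a option"
    and T' :: "'b set" and \<tau>' \<sigma>' :: "'b topology"
    and B\<tau>' B\<sigma>' :: "nat \<Rightarrow> 'b set option"
    and prec\<tau>' prec\<sigma>' :: "nat \<Rightarrow> nat \<Rightarrow> bool"
    and x' :: "nat \<Rightarrow> 'b option"
    and F :: "'a \<Rightarrow> 'b"
  assumes "goedel_numbering \<phi>"
    and "bitopological T \<tau> \<sigma>"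
    and "strong_t0_space \<tau> B\<tau> prec\<tau>" and "strong_t0_space \<sigma> B\<sigma> prec\<sigma>"
    and "countable T" and "second_countable \<tau>" and "second_countable \<sigma>"
    and "numbering T x" and "bi_computable x B\<tau> B\<sigma>"
    and "bitopological T' \<tau>' \<sigma>'"
    and "strong_t0_space \<tau>' B\<tau>' prec\<tau>'" and "strong_t0_space \<sigma>' B\<sigma>' prec\<sigma>'"
    and "numbering T' x'"
    and "bi_effective x' B\<tau>' prec\<tau>' B\<sigma>' prec\<sigma>'"
    and "ce_rel prec\<tau>'" and "ce_rel prec\<sigma>'"
    and "allows_effective_bi_limit_passing \<phi> x' \<tau>' B\<tau>' prec\<tau>' \<sigma>' B\<sigma>' prec\<sigma>'"
    and "F \<in> T \<rightarrow> T'"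
    and "effectively_bi_continuous \<phi> T B\<tau> B\<sigma> B\<tau>' B\<sigma>' F"
  shows "effective_operator x x' F"
proof -
  have \<phi>: "\<phi> \<in> P2" using assms(1) unfolding goedel_numbering_def by blast
  have x: "ran x = T" using assms(8) unfolding numbering_def .
  have total: "dom B\<tau>' = UNIV" "dom B\<sigma>' = UNIV"
    using assms(14) unfolding bi_effective_def effective_space_def by blast+
  let ?y = "\<lambda>i. F (the (x i))"
  have y: "?y i \<in> topspace \<tau>'" "?y i \<in> topspace \<sigma>'" if "i \<in> dom x" for i
    using that x assms(10,18) unfolding bitopological_def by (auto simp: ran_def)
  have x_comp: "computable_numbering x B\<tau>" "computable_numbering x B\<sigma>"
    using assms(9) unfolding bi_computable_def by auto
  have F: "effectively_continuous \<phi> T B\<tau> B\<tau>' F" "effectively_continuous \<phi> T B\<sigma> B\<sigma>' F"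
    using assms(19) unfolding effectively_bi_continuous_def by auto

  obtain N where N: "partial_recursive 2 N"
    "\<And>i n. i \<in> dom x \<Longrightarrow> N [i, n] \<noteq> None \<longleftrightarrow> ?y i \<in> the (B\<tau>' n)"
    using enumerable_image_neighbourhoods[OF \<phi> x x_comp(1) total(1) F(1)] by blast
  obtain s where s: "total_computable s"
    "\<And>i. i \<in> dom x \<Longrightarrow> converging_index \<phi> \<tau>' B\<tau>' prec\<tau>' (s i) (?y i)"
    using computable_converging_indices[where y = ?y and N = N and I = "dom x", OF assms(1,11) total(1) assms(15) N y(1)] by blast
  obtain M where M: "partial_recursive 2 M"
    "\<And>i n. i \<in> dom x \<Longrightarrow> M [i, n] \<noteq> None \<longleftrightarrow> ?y i \<in> the (B\<sigma>' n)"
    using enumerable_image_neighbourhoods[OF \<phi> x x_comp(2) total(2) F(2)] by blast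
  obtain t where t: "total_computable t"
    "\<And>i. i \<in> dom x \<Longrightarrow> converging_index \<phi> \<sigma>' B\<sigma>' prec\<sigma>' (t i) (?y i)"
    using computable_converging_indices[where y = ?y and N = M and I = "dom x", OF assms(1,12) total(2) assms(16) M y(2)] by blast

  obtain pt where pt: "pt \<in> P1" "\<And>m n z. \<lbrakk>converging_index \<phi> \<tau>' B\<tau>' prec\<tau>' m z;
      converging_index \<phi> \<sigma>' B\<sigma>' prec\<sigma>' n z\<rbrakk> \<Longrightarrow> \<exists>j. pt (prod_encode (m, n)) = Some j \<and> x' j = Some z"
    using assms(17) unfolding allows_effective_bi_limit_passing_def by blast
  have "total_recursive 1 (\<lambda>xs. s (xs ! 0))" "total_recursive 1 (\<lambda>xs. t (xs ! 0))"
    using s(1) t(1) unfolding total_computable_def P1_iff total_recursive_def by auto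
  \<comment> \<open>Both indices describe enumerations converging to the same point, the image of
    the element with index \<open>i\<close>, so \<open>pt\<close> applied to their pair realizes the
    operator.\<close>
  then have "(\<lambda>i. pt (prod_encode (s i, t i))) \<in> P1"
    unfolding P1_iff by (intro partial_recursive_subst1 pt(1) total_recursive_prod_encode)
  then show ?thesis
    unfolding effective_operator_def using pt(2)[OF s(2) t(2)] by (intro bexI) auto
qed

end
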